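(* Let $P>1$ be an integer. Let $g$ be the impulse response of a finite-dimensional causal discrete-time LTI system such that $g\in\ell_1$, the support of $g$ is $\{t_1+i: i\in\mathbb{Z}_{\ge 0}\}$ for some $t_1\in\mathbb{Z}_{\ge 0}$, and $g$ is strictly monotonically decreasing on its support. Let $u:\mathbb{Z}\to\mathbb{R}$ be $P$-periodic with $S_c^-(\Delta_c u^P)=2$ and $S_c^+(u^P)=2$, and let $$o^P:=-H_{\overline{g}^P}\,\mathrm{sign}(u^P)\in\mathbb{R}^P .$$ If $P_p(u^P)=P_p(o^P)$ and $P_n(u^P)=P_n(o^P)$, then $P_p(u^P)=P_n(u^P)$. If additionally $P_z(u^P)=0$, then $P=2P_p(u^P)=2P_p(o^P)$.
   Context: Finite-dimensional causal LTI system: its impulse response $g:\mathbb{Z}\to\mathbb{R}$ satisfies $g(t)=0$ for $t<0$ and $G(z)=\sum_{t\ge 0}g(t)z^{-t}$ is rational. $g\in\ell_1$ means $\sum_{t}|g(t)|<\infty$. For a $P$-periodic sequence $x$, $x^P:=[x(0),\dots,x(P-1)]^\top$. The periodic summation of $g$ is $\overline{g}(t):=\sum_{i\in\mathbb{Z}}g(t+iP)$, which is $P$-periodic. For $v\in\mathbb{R}^n$, $H_v\in\mathbb{R}^{n\times n}$ is the circulant matrix with first column $v$, each further column being the cyclic downward shift of the previous one, i.e. $(H_v)_{ij}=v_{((i-j)\bmod n)+1}$. Thus $(H_{\overline g^P}w^P)$ is one period of $g*w$ for $P$-periodic $w$. $\mathrm{sign}(t)=1,0,-1$ for $t>0$,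 $t=0$, $t<0$, applied entrywise to vectors. $P_p(v),P_n(v),P_z(v)$ denote the numbers of positive, negative and zero entries of $v$. Cyclic forward difference: $\Delta_c v:=[v_2-v_1,\,v_3-v_2,\dots,v_1-v_n]^\top$. Variation: $S^-(v)$ is the number of sign changes between consecutive entries of the vector obtained from $v$ by deleting all zeros, with $S^-(0)=-1$. Cyclic variation: $S_c^-(v):=\max_{1\le i\le n}S^-([v_i,\dots,v_n,v_1,\dots,v_i])$. $S_c^+(v)$ is the maximum of $S_c^-(\bar v)$ over all $\bar v\in\mathbb{R}^n$ obtained from $v$ by replacing its zero entries by arbitrary real numbers. *)

theory Defs
  imports
    "HOL-Analysis.Infinite_Sum"
    "HOL-Computational_Algebra.Polynomial"
    "Jordan_Normal_Form.Matrix"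
begin

text \<open>Vectors in \<open>\<real>\<^sup>n\<close> are \<^typ>\<open>real vec\<close> of dimension \<open>n\<close>; indices start at 0 instead of 1.\<close>

text \<open>The transfer function \<open>G(z) = (\<Sum>t\<ge>0. g(t) z\<^sup>-\<^sup>t)\<close> is required to agree with a rational function
  with real coefficients outside some disc, that is, near \<open>z = \<infinity>\<close>.\<close>

definition fd_causal_impulse_response :: "(int \<Rightarrow> real) \<Rightarrow> bool" where
  "fd_causal_impulse_response g \<longleftrightarrow>
     (\<forall>t<0. g t = 0) \<and>
     (\<exists>(p :: real poly) (q :: real poly) (R :: real). q \<noteq> 0 \<and>
        (\<forall>z::complex. norm z > R \<longrightarrow>
           poly (map_poly of_real q) z \<noteq> 0 \<and>
           (\<lambda>t::nat. of_real (g (int t)) / z ^ t) sums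
             (poly (map_poly of_real p) z / poly (map_poly of_real q) z)))"

definition periodic :: "nat \<Rightarrow> (int \<Rightarrow> real) \<Rightarrow> bool" where
  "periodic P x \<longleftrightarrow> (\<forall>t. x (t + int P) = x t)"

definition one_period :: "nat \<Rightarrow> (int \<Rightarrow> real) \<Rightarrow> real vec" where
  "one_period P x = vec P (\<lambda>i. x (int i))"

definition periodic_summation :: "nat \<Rightarrow> (int \<Rightarrow> real) \<Rightarrow> int \<Rightarrow> real" where
  "periodic_summation P g t = (\<Sum>\<^sub>\<infinity>i::int. g (t + i * int P))"

text \<open>The index \<open>i - j\<close> is computed in the integers, so that it is not truncated.\<close>

definition circulant :: "real vec \<Rightarrow> real mat" where
  "circulant v = (let n = dim_vec v in
     mat n n (\<lambda>(i, j). v $ nat ((int i - int j) mod int n)))"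

definition num_pos :: "real vec \<Rightarrow> nat" where
  "num_pos v = card {i. i < dim_vec v \<and> v $ i > 0}"

definition num_neg :: "real vec \<Rightarrow> nat" where
  "num_neg v = card {i. i < dim_vec v \<and> v $ i < 0}"

definition num_zero :: "real vec \<Rightarrow> nat" where
  "num_zero v = card {i. i < dim_vec v \<and> v $ i = 0}"

definition cyclic_diff :: "real vec \<Rightarrow> real vec" where
  "cyclic_diff v = (let n = dim_vec v in vec n (\<lambda>i. v $ (Suc i mod n) - v $ i))"

definition variation :: "real list \<Rightarrow> int" where
  "variation xs = (let ys = filter (\<lambda>x. x \<noteq> 0) xs in
     if ys = [] then - 1
     else int (card {i. Suc i < length ys \<and> sgn (ys ! i) \<noteq> sgn (ys ! Suc i)}))"

text \<open>The list below has \<open>n + 1\<close> entries \<open>v\<^sub>i, \<dots>, v\<^sub>n, v\<^sub>1, \<dots>, v\<^sub>i\<close>: the starting entry is repeated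
  at the end.\<close>

definition cyclic_variation_minus :: "real vec \<Rightarrow> int" where
  "cyclic_variation_minus v = (let n = dim_vec v in
     Max ((\<lambda>i. variation (map (\<lambda>k. v $ ((i + k) mod n)) [0..<Suc n])) ` {..<n}))"

text \<open>There are infinitely many ways to replace the zero entries, but only finitely many values of
  the cyclic variation; see \<open>finite_zero_replacement_variations\<close> below.\<close>

definition cyclic_variation_plus :: "real vec \<Rightarrow> int" where
  "cyclic_variation_plus v =
     Max {cyclic_variation_minus w | w.
            dim_vec w = dim_vec v \<and> (\<forall>i < dim_vec v. v $ i \<noteq> 0 \<longrightarrow> w $ i = v $ i)}"

lemma variation_bounds: "- 1 \<le> variation xs" "variation xs \<le> int (length xs)"
proof -
  define ys where "ys = filter (\<lambda>x. x \<noteq> 0) xs"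
  have "card {i. Suc i < length ys \<and> sgn (ys ! i) \<noteq> sgn (ys ! Suc i)} \<le> card {..<length ys}"
    by (rule card_mono) auto
  also have "\<dots> \<le> length xs"
    by (simp add: ys_def)
  finally show "- 1 \<le> variation xs" "variation xs \<le> int (length xs)"
    by (auto simp: variation_def ys_def[symmetric] Let_def)
qed

lemma cyclic_variation_minus_bounds:
  assumes "dim_vec v > 0"
  shows "cyclic_variation_minus v \<in> {- 1..int (dim_vec v) + 1}"
proof -
  let ?f = "\<lambda>i. variation (map (\<lambda>k. v $ ((i + k) mod dim_vec v)) [0..<Suc (dim_vec v)])"
  have "Max (?f ` {..<dim_vec v}) \<in> ?f ` {..<dim_vec v}"
    using assms by (intro Max_in) auto
  moreover have "?f i \<in> {- 1..int (dim_vec v) + 1}" for i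
    using variation_bounds[of "map (\<lambda>k. v $ ((i + k) mod dim_vec v)) [0..<Suc (dim_vec v)]"]
    by (simp del: upt_Suc)
  ultimately show ?thesis
    unfolding cyclic_variation_minus_def Let_def by (elim imageE) (simp only:)
qed

lemma finite_zero_replacement_variations:
  assumes "dim_vec v > 0"
  shows "finite {cyclic_variation_minus w | w.
           dim_vec w = dim_vec v \<and> (\<forall>i < dim_vec v. v $ i \<noteq> 0 \<longrightarrow> w $ i = v $ i)}"
proof (rule finite_subset)
  show "{cyclic_variation_minus w | w.
           dim_vec w = dim_vec v \<and> (\<forall>i < dim_vec v. v $ i \<noteq> 0 \<longrightarrow> w $ i = v $ i)}
        \<subseteq> {- 1..int (dim_vec v) + 1}"
  proof
    fix k
    assume "k \<in> {cyclic_variation_minus w | w.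
           dim_vec w = dim_vec v \<and> (\<forall>i < dim_vec v. v $ i \<noteq> 0 \<longrightarrow> w $ i = v $ i)}"
    then obtain w where "k = cyclic_variation_minus w" "dim_vec w = dim_vec v"
      by blast
    with cyclic_variation_minus_bounds[of w] assms show "k \<in> {- 1..int (dim_vec v) + 1}"
      by simp
  qed
qed simp

end

theory Submission
  imports Defs "HOL-Library.Periodic_Fun"
begin

text \<open>
  Write \<open>s = sign u\<close>, let \<open>a\<close> and \<open>b\<close> be the numbers of positive and of negative entries of \<open>u\<close> in one
  period, and let \<open>h\<close> be the periodic summation of \<open>g\<close>, so that the output is \<open>- F\<close>, where \<open>F\<close> is the
  cyclic convolution of \<open>h\<close> and \<open>s\<close>. A summable \<open>g\<close> that decreases strictly on its support is positive
  there, and hence \<open>h > 0\<close> everywhere.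

  The proof excludes \<open>a > b\<close> by pairing every time \<open>t\<close> with \<open>t + a\<close>. Cyclic variation
  \<open>S\<^sub>c\<^sup>+(u) = 2\<close> forbids four cyclically ordered times at which \<open>u\<close> is alternately \<open>\<le> 0\<close> and \<open>\<ge> 0\<close>
  (lemma \<open>cyclic_variation_plus_ge_3\<close>). Together with \<open>a > b\<close> this gives \<open>s(t) + s(t + a) \<ge> 0\<close> for all
  \<open>t\<close> (lemma \<open>sgn_add_translate_nonneg\<close>): shifting by the number of positive entries moves every negative
  entry onto a positive one, since the positive entries form a block longer than the negative one. As
  these sums add up to \<open>2 (a - b) > 0\<close> over a period, convolving them with the positive \<open>h\<close> gives
  \<open>F(t) + F(t + a) > 0\<close> for every \<open>t\<close>. So one of \<open>F(t)\<close>, \<open>F(t + a)\<close> is positive, and counting over a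
  period shows that \<open>F\<close> is positive at no fewer than \<open>P / 2 \<ge> (a + b) / 2 > b\<close> times
  (lemma \<open>count_pos_convolution\<close>). Then the output has more than \<open>b\<close> negative entries, contrary to the
  assumption on the counts. The case \<open>a < b\<close> follows by applying this to \<open>- u\<close>, whose
  convolution is \<open>- F\<close>. Hence \<open>a = b\<close>, and without zero entries \<open>P = a + b = 2 a\<close>.
\<close>

section \<open>Sums and counts over one period\<close>

lemma periodic_mod:
  assumes "periodic P f"
  shows "f (x mod int P) = f x"
proof -
  interpret periodic_fun_simple f "int P"
    using assms by unfold_locales (simp add: periodic_def)
  have "f (x mod int P + of_int (x div int P) * int P) = f (x mod int P)"
    by (rule plus_of_int)
  then show ?thesis by simp
qed

text \<open>Reduction modulo \<open>P\<close> maps any \<open>P\<close> consecutive integers bijectively to \<open>{0..<P}\<close>. Periodicity is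
  expressed by invariance under this reduction, so that the lemma also serves summands of other types
  than \<^typ>\<open>real\<close>, such as the indicators that count times.\<close>
lemma sum_window:
  assumes "P > 0" and f: "\<And>x. f (x mod int P) = f x"
  shows "(\<Sum>j\<in>{c..<c + int P}. f j) = (\<Sum>j\<in>{0..<int P}. f j)"
proof -
  have inj: "inj_on (\<lambda>j. j mod int P) {c..<c + int P}"
  proof (rule inj_onI)
    fix x y assume xy: "x \<in> {c..<c + int P}" "y \<in> {c..<c + int P}" "x mod int P = y mod int P"
    then have "int P dvd x - y" by (simp add: mod_eq_dvd_iff)
    moreover have "\<bar>x - y\<bar> < int P" using xy by auto
    ultimately show "x = y" using zdvd_not_zless[of "\<bar>x - y\<bar>" "int P"] by fastforce
  qed
  have sub: "(\<lambda>j. j mod int P) ` {c..<c + int P} \<subseteq> {0..<int P}"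
    using assms(1) by auto
  have "(\<lambda>j. j mod int P) ` {c..<c + int P} = {0..<int P}"
    using card_image[OF inj] by (intro card_subset_eq sub) simp_all
  with inj have "bij_betw (\<lambda>j. j mod int P) {c..<c + int P} {0..<int P}"
    by (simp add: bij_betw_def)
  from sum.reindex_bij_betw[OF this, of f] show ?thesis by (simp add: f)
qed

lemma sum_shift:
  assumes "P > 0" and f: "\<And>x. f (x mod int P) = f x"
  shows "(\<Sum>j\<in>{0..<int P}. f (j + c)) = (\<Sum>j\<in>{0..<int P}. f j)"
proof -
  have "bij_betw (\<lambda>j. j + c) {0..<int P} {c..<c + int P}"
    by (rule bij_betwI[where g = "\<lambda>j. j - c"]) auto
  from sum.reindex_bij_betw[OF this, of f] sum_window[of P f c, OF assms] show ?thesis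
    by simp
qed

definition count_period :: "nat \<Rightarrow> (int \<Rightarrow> bool) \<Rightarrow> nat" where
  "count_period P Q = card {j \<in> {0..<int P}. Q j}"

lemma sum_of_bool_eq_card_filter:
  "finite A \<Longrightarrow> (\<Sum>j\<in>A. of_bool (Q j)) = card {j \<in> A. Q j}"
  by (simp add: Int_def)

lemma count_period_window:
  assumes "P > 0" and "\<And>x. Q (x mod int P) = Q x"
  shows "card {j \<in> {c..<c + int P}. Q j} = count_period P Q"
  using sum_window[of P "\<lambda>j. of_bool (Q j) :: nat" c] assms
  by (simp add: sum_of_bool_eq_card_filter count_period_def del: sum_of_bool_eq)

lemma count_period_shift:
  assumes "P > 0" and "\<And>x. Q (x mod int P) = Q x"
  shows "count_period P (\<lambda>j. Q (j + c)) = count_period P Q"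
  using sum_shift[of P "\<lambda>j. of_bool (Q j) :: nat" c] assms
  by (simp add: sum_of_bool_eq_card_filter count_period_def del: sum_of_bool_eq)

lemma card_one_period: "card {i. i < P \<and> Q (int i)} = count_period P Q"
proof -
  have "bij_betw int {i. i < P \<and> Q (int i)} {j \<in> {0..<int P}. Q j}"
    by (rule bij_betwI[where g = nat]) auto
  then show ?thesis unfolding count_period_def by (rule bij_betw_same_card)
qed

section \<open>Sign changes\<close>

fun sign_changes :: "real list \<Rightarrow> nat" where
  "sign_changes (x # y # zs) = of_bool (sgn x \<noteq> sgn y) + sign_changes (y # zs)"
| "sign_changes _ = 0"

lemma sign_changes_eq_card:
  "sign_changes xs = card {i. Suc i < length xs \<and> sgn (xs ! i) \<noteq> sgn (xs ! Suc i)}"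
proof (induction xs rule: sign_changes.induct)
  case (1 x y zs)
  let ?A = "{i. Suc i < length (y # zs) \<and> sgn ((y # zs) ! i) \<noteq> sgn ((y # zs) ! Suc i)}"
  have fin: "finite ?A" by (rule finite_subset[of _ "{..<length (y # zs)}"]) auto
  have "{i. Suc i < length (x # y # zs) \<and> sgn ((x # y # zs) ! i) \<noteq> sgn ((x # y # zs) ! Suc i)}
      = (if sgn x \<noteq> sgn y then {0} else {}) \<union> Suc ` ?A" (is "?L = ?R")
  proof (rule Set.set_eqI)
    fix i show "i \<in> ?L \<longleftrightarrow> i \<in> ?R" by (cases i) (auto simp: image_iff)
  qed
  moreover have "card ?R = of_bool (sgn x \<noteq> sgn y) + card ?A"
    using fin by (subst card_Un_disjoint) (auto simp: card_image)
  ultimately show ?case using 1 by simp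
qed auto

text \<open>If all entries of \<open>l\<close> had the sign of \<open>x\<close>, the change from \<open>x\<close> to \<open>y\<close> would still occur at the end
  of \<open>l\<close>; so inserting entries loses no sign change.\<close>
lemma sign_changes_skip:
  "of_bool (sgn x \<noteq> sgn y) + sign_changes (y # r) \<le> sign_changes (x # l @ y # r)"
proof (induction l arbitrary: x)
  case (Cons z l)
  show ?case using Cons[of z] by (cases "sgn x = sgn z") auto
qed simp

lemma variation_alternating:
  assumes "a < 0" "b > 0" "c < 0" "d > 0"
  shows "variation (a # l1 @ b # l2 @ c # l3 @ d # l4) \<ge> 3"
proof -
  let ?f = "filter (\<lambda>x. x \<noteq> (0::real))"
  let ?ys = "a # ?f l1 @ b # ?f l2 @ c # ?f l3 @ d # ?f l4"
  have "?f (a # l1 @ b # l2 @ c # l3 @ d # l4) = ?ys"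
    using assms by simp
  then have eq: "variation (a # l1 @ b # l2 @ c # l3 @ d # l4) = int (sign_changes ?ys)"
    unfolding variation_def Let_def sign_changes_eq_card by simp
  have "sign_changes ?ys \<ge> 3"
    using sign_changes_skip[of a b "?f l2 @ c # ?f l3 @ d # ?f l4" "?f l1"]
      sign_changes_skip[of b c "?f l3 @ d # ?f l4" "?f l2"]
      sign_changes_skip[of c d "?f l4" "?f l3"] assms
    by simp
  with eq show ?thesis by simp
qed

text \<open>Weak inequalities are used because a zero entry may be replaced by a number of either
  sign.\<close>
definition cyclically_alternating :: "nat \<Rightarrow> (int \<Rightarrow> real) \<Rightarrow> bool" where
  "cyclically_alternating P u \<longleftrightarrow> (\<exists>p0 p1 p2 p3. p0 < p1 \<and> p1 < p2 \<and> p2 < p3 \<and> p3 < p0 + int P \<and>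
     u p0 \<le> 0 \<and> u p1 \<ge> 0 \<and> u p2 \<le> 0 \<and> u p3 \<ge> 0)"

text \<open>Moving the first of the four times to the end of the period turns the pattern \<open>+ - + -\<close> into
  \<open>- + - +\<close>.\<close>
lemma cyclically_alternating_uminus:
  assumes "periodic P u" and "cyclically_alternating P (\<lambda>t. - u t)"
  shows "cyclically_alternating P u"
proof -
  obtain p0 p1 p2 p3 where "p0 < p1" "p1 < p2" "p2 < p3" "p3 < p0 + int P"
    "u p0 \<ge> 0" "u p1 \<le> 0" "u p2 \<ge> 0" "u p3 \<le> 0"
    using assms(2) unfolding cyclically_alternating_def by auto
  moreover have "u (p0 + int P) = u p0" using assms(1) by (simp add: periodic_def)
  ultimately show ?thesis unfolding cyclically_alternating_def
    by (intro exI[of _ p1] exI[of _ p2] exI[of _ p3] exI[of _ "p0 + int P"]) auto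
qed

text \<open>The cyclic variation compares only starting points inside one period; by periodicity a walk
  around the cycle may start at any integer \<open>c\<close>.\<close>
lemma variation_le_cyclic_variation_minus:
  assumes "P > 0" and "periodic P x"
  shows "variation (map (\<lambda>k. x (c + int k)) [0..<Suc P]) \<le> cyclic_variation_minus (one_period P x)"
proof -
  let ?v = "one_period P x"
  let ?f = "\<lambda>i. variation (map (\<lambda>k. ?v $ ((i + k) mod P)) [0..<Suc P])"
  define i where "i = nat (c mod int P)"
  have i: "i < P" "int i = c mod int P" using assms(1) by (auto simp: i_def nat_less_iff)
  have entry: "?v $ ((i + k) mod P) = x (c + int k)" for k
  proof -
    have "?v $ ((i + k) mod P) = x (int ((i + k) mod P))"
      using assms(1) by (simp add: one_period_def)
    also have "int ((i + k) mod P) = (c + int k) mod int P"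
      by (simp add: of_nat_mod i(2) mod_add_left_eq)
    finally show ?thesis by (simp add: periodic_mod[OF assms(2)])
  qed
  have "?f i \<le> Max (?f ` {..<P})" using i(1) by (intro Max_ge) auto
  then show ?thesis
    unfolding cyclic_variation_minus_def Let_def by (simp only: entry) (simp add: one_period_def)
qed

text \<open>Zeros at the four times can be replaced by numbers that make the alternation strict, and a walk
  once around the cycle from the first of these times then has at least three sign changes.\<close>
lemma cyclic_variation_plus_ge_3:
  assumes P: "P > 0" and per: "periodic P u" and alt: "cyclically_alternating P u"
  shows "cyclic_variation_plus (one_period P u) \<ge> 3"
proof -
  obtain p0 p1 p2 p3 where p: "p0 < p1" "p1 < p2" "p2 < p3" "p3 < p0 + int P"
    and up: "u p0 \<le> 0" "u p1 \<ge> 0" "u p2 \<le> 0" "u p3 \<ge> 0"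
    using alt unfolding cyclically_alternating_def by auto
  \<comment> \<open>Zeros become negative at the residues of \<open>p0\<close> and \<open>p2\<close> and positive elsewhere, in
    particular at \<open>p1\<close> and \<open>p3\<close>, which lie in other residue classes.\<close>
  define w where "w t = (if u t \<noteq> 0 then u t
    else if t mod int P = p0 mod int P \<or> t mod int P = p2 mod int P then -1 else 1)" for t
  have wper: "periodic P w" using per by (simp add: w_def periodic_def)
  have ne: "x mod int P \<noteq> y mod int P" if "x < y" "y < x + int P" for x y
    using that by (metis diff_gt_0_iff_gt add.commute diff_less_eq mod_eq_dvd_iff zdvd_not_zless)
  have w: "w p0 < 0" "w p1 > 0" "w p2 < 0" "w p3 > 0"
    using up p ne[of p0 p1] ne[of p1 p2] ne[of p0 p3] ne[of p2 p3] by (auto simp: w_def)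
  define k1 k2 k3 where "k1 = nat (p1 - p0)" and "k2 = nat (p2 - p0)" and "k3 = nat (p3 - p0)"
  have k: "0 < k1" "k1 < k2" "k2 < k3" "k3 < Suc P"
    using p by (auto simp: k1_def k2_def k3_def)
  have pk: "p0 + int k1 = p1" "p0 + int k2 = p2" "p0 + int k3 = p3"
    using p by (auto simp: k1_def k2_def k3_def)
  have split: "[m..<n] = [m..<j] @ j # [Suc j..<n]" if "m \<le> j" "j < n" for m j n
    using that upt_add_eq_append[of m j "n - j"] by (simp add: upt_conv_Cons)
  have "[0..<Suc P] = 0 # [Suc 0..<k1] @ k1 # [Suc k1..<k2] @ k2 # [Suc k2..<k3] @ k3 # [Suc k3..<Suc P]"
    using split[of 0 0 "Suc P"] split[of "Suc 0" k1 "Suc P"] split[of "Suc k1" k2 "Suc P"]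
      split[of "Suc k2" k3 "Suc P"] k by (simp del: upt_Suc)
  then have "variation (map (\<lambda>k. w (p0 + int k)) [0..<Suc P]) \<ge> 3"
    using w by (simp add: pk variation_alternating del: upt_Suc)
  also note variation_le_cyclic_variation_minus[OF P wper, of p0]
  also have "cyclic_variation_minus (one_period P w) \<le> cyclic_variation_plus (one_period P u)"
    unfolding cyclic_variation_plus_def
    using P by (intro Max_ge finite_zero_replacement_variations)
      (auto simp: one_period_def w_def intro!: exI[of _ "one_period P w"])
  finally show ?thesis .
qed

section \<open>The sign pattern and its translate\<close>

text \<open>Suppose that \<open>u\<close> is nonpositive at both \<open>t\<close> and \<open>t + a\<close>. The \<open>a - 1\<close> times strictly between
  them cannot hold all \<open>a\<close> positive entries, so there is a positive entry on the other arc of the cycle.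
  Without alternation \<open>u\<close> is therefore negative at all \<open>a - 1\<close> times in between. If \<open>u\<close> is also negative at
  one of the two end points, this makes \<open>a\<close> negative entries, more than there are.\<close>
lemma sgn_add_translate_nonneg:
  assumes P: "P > 0" and per: "periodic P u" and alt: "\<not> cyclically_alternating P u"
    and a: "a = count_period P (\<lambda>t. u t > 0)"
    and less: "count_period P (\<lambda>t. u t < 0) < a"
  shows "sgn (u t) + sgn (u (t + int a)) \<ge> 0"
proof (rule ccontr)
  assume neg: "\<not> ?thesis"
  then have le: "u t \<le> 0" "u (t + int a) \<le> 0" and lt: "u t < 0 \<or> u (t + int a) < 0"
    by (auto simp: sgn_if split: if_splits)
  note m = periodic_mod[OF per]
  let ?W = "{t..<t + int P}"
  have cp: "card {j \<in> ?W. u j > 0} = a" 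
    unfolding a by (rule count_period_window[OF P]) (simp add: m)
  have cn: "card {j \<in> ?W. u j < 0} < a" 
    using less by (subst count_period_window[OF P]) (simp_all add: m)
  have aP: "int a < int P"
  proof -
    have "j \<in> {t<..<t + int P}" if "j \<in> ?W" "u j > 0" for j
      using that le(1) by (cases "j = t") auto
    then have "{j \<in> ?W. u j > 0} \<subseteq> {t<..<t + int P}" by blast
    then have "card {j \<in> ?W. u j > 0} \<le> card {t<..<t + int P}" by (intro card_mono) simp_all
    with P cp show ?thesis by simp
  qed
  have a0: "0 < a" using less by simp
  have "\<not> {j \<in> ?W. u j > 0} \<subseteq> {t<..<t + int a}"
  proof
    assume "{j \<in> ?W. u j > 0} \<subseteq> {t<..<t + int a}"
    then have "card {j \<in> ?W. u j > 0} \<le> card {t<..<t + int a}" by (intro card_mono) simp_all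
    with cp a0 show False by simp
  qed
  then obtain q where q: "q \<in> ?W" "u q > 0" "q \<notin> {t<..<t + int a}" by blast
  moreover have "q \<noteq> t" "q \<noteq> t + int a" using le q(2) by auto
  ultimately have q': "t + int a < q" "q < t + int P" by auto
  have between: "u p < 0" if "t < p" "p < t + int a" for p
  proof (rule ccontr)
    assume "\<not> u p < 0"
    then have "cyclically_alternating P u"
      unfolding cyclically_alternating_def using that le q(2) q'
      by (intro exI[of _ t] exI[of _ p] exI[of _ "t + int a"] exI[of _ q]) auto
    with alt show False ..
  qed
  \<comment> \<open>The end point \<open>c\<close> is the missing \<open>a\<close>-th negative entry.\<close>
  obtain c where c: "c \<in> {t, t + int a}" "u c < 0" using lt by auto
  have "insert c {t<..<t + int a} \<subseteq> {j \<in> ?W. u j < 0}" using c between aP by auto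
  then have "card (insert c {t<..<t + int a}) \<le> card {j \<in> ?W. u j < 0}"
    by (rule card_mono[rotated]) (rule finite_subset[of _ ?W], auto)
  with cn have "card (insert c {t<..<t + int a}) < a" by simp
  moreover have "card (insert c {t<..<t + int a}) = a" using c a0 by (subst card_insert_disjoint) auto
  ultimately show False by simp
qed

definition cyclic_convolution :: "nat \<Rightarrow> (int \<Rightarrow> real) \<Rightarrow> (int \<Rightarrow> real) \<Rightarrow> int \<Rightarrow> real" where
  "cyclic_convolution P h s t = (\<Sum>j\<in>{0..<int P}. h (t - j) * s j)"

lemma periodic_cyclic_convolution:
  assumes "periodic P h"
  shows "periodic P (cyclic_convolution P h s)"
proof -
  have "h (t + int P - j) = h (t - j)" for t j
    using assms unfolding periodic_def by (metis add.commute add_diff_eq)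
  then show ?thesis unfolding periodic_def cyclic_convolution_def by simp
qed

lemma cyclic_convolution_shift:
  assumes "P > 0" "periodic P h" "periodic P s"
  shows "cyclic_convolution P h s (t + c) = cyclic_convolution P h (\<lambda>j. s (j + c)) t"
proof -
  let ?f = "\<lambda>j. h (t + c - j) * s j"
  have "?f (x mod int P) = ?f x" for x
    by (metis (mono_tags, lifting) assms(2,3) mod_diff_right_eq periodic_mod)
  from sum_shift[of P ?f c, OF assms(1) this] show ?thesis
    by (simp add: cyclic_convolution_def algebra_simps)
qed

lemma count_sgn_sum:
  "(\<Sum>j\<in>{0..<int P}. sgn (u j :: real)) =
     real (count_period P (\<lambda>t. u t > 0)) - real (count_period P (\<lambda>t. u t < 0))"
proof -
  have "(\<Sum>j\<in>{0..<int P}. sgn (u j)) = (\<Sum>j\<in>{0..<int P}. of_bool (u j > 0) - of_bool (u j < 0))"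
    by (rule sum.cong) (auto simp: sgn_if)
  then show ?thesis by (simp add: sum_subtractf count_period_def Int_def)
qed

lemma count_period_sum_le:
  assumes "P > 0"
  shows "count_period P (\<lambda>t. (u t :: real) > 0) + count_period P (\<lambda>t. u t < 0) \<le> P"
proof -
  have "card {j \<in> {0..<int P}. u j > 0} + card {j \<in> {0..<int P}. u j < 0}
      = card ({j \<in> {0..<int P}. u j > 0} \<union> {j \<in> {0..<int P}. u j < 0})"
    by (rule card_Un_disjoint[symmetric]) (simp_all del: atLeastLessThan_iff, auto)
  also have "\<dots> \<le> card {0..<int P}" by (rule card_mono) (simp, blast)
  finally show ?thesis by (simp add: count_period_def)
qed

text \<open>Since \<open>h\<close> is positive, the convolution inherits the sign of \<open>s(t) + s(t + a)\<close>; strictness comes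
  from a single time at which that sum is positive.\<close>
lemma count_pos_convolution:
  assumes P: "P > 0" and per: "periodic P u" and alt: "\<not> cyclically_alternating P u"
    and h: "periodic P h" "\<And>t. h t > 0"
    and less: "count_period P (\<lambda>t. u t < 0) < count_period P (\<lambda>t. u t > 0)"
  shows "count_period P (\<lambda>t. u t < 0)
    < count_period P (\<lambda>t. cyclic_convolution P h (\<lambda>j. sgn (u j)) t > 0)"
proof -
  define a where "a = count_period P (\<lambda>t. u t > 0)"
  let ?s = "\<lambda>j. sgn (u j)"
  let ?F = "cyclic_convolution P h ?s"
  let ?\<sigma> = "\<lambda>j. ?s j + ?s (j + int a)"
  have sper: "periodic P ?s" using per by (simp add: periodic_def)
  have nonneg: "?\<sigma> j \<ge> 0" for j
    using sgn_add_translate_nonneg[OF P per alt a_def] less by (simp add: a_def)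
  have "(\<Sum>j\<in>{0..<int P}. ?\<sigma> j) = 2 * (\<Sum>j\<in>{0..<int P}. ?s j)"
    using sum_shift[of P ?s "int a", OF P periodic_mod[OF sper]] by (simp add: sum.distrib)
  also have "\<dots> > 0" using less by (simp add: count_sgn_sum)
  finally obtain j0 where j0: "j0 \<in> {0..<int P}" "?\<sigma> j0 > 0"
    by (metis (no_types, lifting) leD linorder_not_less sum_nonpos)
  have pos: "?F t + ?F (t + int a) > 0" for t
  proof -
    have "?F t + ?F (t + int a) = (\<Sum>j\<in>{0..<int P}. h (t - j) * ?\<sigma> j)"
      unfolding cyclic_convolution_shift[OF P h(1) sper]
      by (simp add: cyclic_convolution_def sum.distrib distrib_left)
    also have "\<dots> > 0"
      using j0 h(2) nonneg by (intro sum_pos2[of _ j0]) (auto simp: less_imp_le)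
    finally show ?thesis .
  qed
  let ?Q = "\<lambda>t. ?F t > 0"
  \<comment> \<open>Double counting: the times with positive convolution and their translates by \<open>- a\<close> cover the
    whole period.\<close>
  have "?Q t \<or> ?Q (t + int a)" for t using pos[of t] by linarith
  then have "{0..<int P} = {j \<in> {0..<int P}. ?Q j} \<union> {j \<in> {0..<int P}. ?Q (j + int a)}"
    by blast
  then have "card {0..<int P}
      = card ({j \<in> {0..<int P}. ?Q j} \<union> {j \<in> {0..<int P}. ?Q (j + int a)})"
    by (rule arg_cong)
  also have "\<dots> \<le> count_period P ?Q + count_period P (\<lambda>j. ?Q (j + int a))"
    unfolding count_period_def by (rule card_Un_le)
  also have "\<dots> = 2 * count_period P ?Q"
    by (subst count_period_shift[OF P])
       (simp_all add: periodic_mod[OF periodic_cyclic_convolution[OF h(1)]])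
  finally have "P \<le> 2 * count_period P ?Q" by simp
  then show ?thesis using count_period_sum_le[OF P, of u] less by linarith
qed

section \<open>Periodic summation\<close>

text \<open>If \<open>g\<close> were negative at a point of its support, it would decrease further from there on, and
  infinitely many terms would be bounded away from zero.\<close>
lemma strict_antimono_summable_pos:
  fixes g :: "int \<Rightarrow> real"
  assumes sm: "(\<lambda>t. \<bar>g t\<bar>) summable_on UNIV"
    and supp: "{t. g t \<noteq> 0} = {int t1 + int i | i::nat. True}"
    and anti: "strict_antimono_on {t. g t \<noteq> 0} g"
    and t: "g t \<noteq> 0"
  shows "g t > 0"
proof (rule ccontr)
  assume "\<not> g t > 0"
  then have neg: "g t < 0" using t by simp
  obtain i0 where i0: "t = int t1 + int i0" using t supp by blast
  have le: "\<bar>g t\<bar> \<le> \<bar>g s\<bar>" if "t \<le> s" for s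
  proof (cases "s = t")
    case False
    have "s = int t1 + int (nat (s - int t1))" using that i0 by simp
    then have "g s \<noteq> 0" using supp by blast
    with anti t that False have "g s < g t" by (auto simp: monotone_on_def)
    with neg show ?thesis by simp
  qed simp
  obtain N :: nat where N: "(\<Sum>\<^sub>\<infinity>s. \<bar>g s\<bar>) < real N * \<bar>g t\<bar>"
    using reals_Archimedean3[of "\<bar>g t\<bar>"] t by auto
  have "real N * \<bar>g t\<bar> = (\<Sum>s\<in>{t..<t + int N}. \<bar>g t\<bar>)" by simp
  also have "\<dots> \<le> (\<Sum>s\<in>{t..<t + int N}. \<bar>g s\<bar>)" by (rule sum_mono) (auto intro: le)
  also have "\<dots> \<le> (\<Sum>\<^sub>\<infinity>s. \<bar>g s\<bar>)" by (rule finite_sum_le_infsum[OF sm]) auto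
  finally show False using N by simp
qed

lemma periodic_periodic_summation: "periodic P (periodic_summation P g)"
  unfolding periodic_def
proof
  fix t
  have "bij_betw (\<lambda>i::int. i + 1) UNIV UNIV" by (rule bij_betwI[where g = "\<lambda>i. i - 1"]) auto
  from infsum_reindex_bij_betw[OF this, of "\<lambda>i. g (t + i * int P)"]
  show "periodic_summation P g (t + int P) = periodic_summation P g t"
    by (simp add: periodic_summation_def algebra_simps)
qed

lemma periodic_summation_pos:
  fixes g :: "int \<Rightarrow> real"
  assumes P: "P > 0" and sm: "g summable_on UNIV" and nonneg: "\<And>t. g t \<ge> 0"
    and tail: "\<And>t. t \<ge> t1 \<Longrightarrow> g t > 0"
  shows "periodic_summation P g t > 0"
proof -
  let ?r = "\<lambda>i::int. t + i * int P"
  have inj: "inj ?r" using P by (auto intro: injI)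
  have "g summable_on range ?r" by (rule summable_on_subset_banach[OF sm]) simp
  then have sm': "(\<lambda>i. g (?r i)) summable_on UNIV"
    by (simp add: summable_on_reindex[OF inj] o_def)
  \<comment> \<open>One strictly positive term suffices; since \<open>P \<ge> 1\<close>, the shift by \<open>i\<close> periods passes \<open>t1\<close>.\<close>
  define i where "i = max 0 (t1 - t)"
  have "i * 1 \<le> i * int P" using P by (intro mult_left_mono) (auto simp: i_def)
  then have "t1 \<le> ?r i" by (simp add: i_def)
  then have "0 < (\<Sum>i\<in>{i}. g (?r i))" using tail by simp
  also have "\<dots> \<le> (\<Sum>\<^sub>\<infinity>i. g (?r i))" by (rule finite_sum_le_infsum[OF sm']) (auto simp: nonneg)
  finally show ?thesis by (simp add: periodic_summation_def)
qed

lemma circulant_mult_one_period: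
  assumes P: "P > 0" and h: "periodic P h" and t: "t < P"
  shows "(circulant (one_period P h) *\<^sub>v one_period P s) $ t = cyclic_convolution P h s (int t)"
proof -
  have [simp]: "dim_vec (one_period P x) = P" for x by (simp add: one_period_def)
  have entry: "one_period P h $ nat (k mod int P) = h k" for k
    using P periodic_mod[OF h, of k] by (simp add: one_period_def nat_less_iff)
  have "(circulant (one_period P h) *\<^sub>v one_period P s) $ t
      = (\<Sum>j = 0..<P. h (int t - int j) * s (int j))"
    using t by (simp add: circulant_def Let_def scalar_prod_def entry) (simp add: one_period_def)
  also have "\<dots> = cyclic_convolution P h s (int t)"
  proof -
    have "bij_betw int {0..<P} {0..<int P}" by (rule bij_betwI[where g = nat]) auto
    from sum.reindex_bij_betw[OF this, of "\<lambda>j. h (int t - j) * s j"]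
    show ?thesis by (simp add: cyclic_convolution_def)
  qed
  finally show ?thesis .
qed

section \<open>Balance of positive and negative entries\<close>

theorem theorem1:
  fixes P :: nat and g u :: "int \<Rightarrow> real" and y :: "real vec"
  assumes "P > 1"
    and "fd_causal_impulse_response g"
    and "(\<lambda>t. \<bar>g t\<bar>) summable_on UNIV"
    and "\<exists>t1::nat. {t. g t \<noteq> 0} = {int t1 + int i | i::nat. True}"
    and "strict_antimono_on {t. g t \<noteq> 0} g"
    and "periodic P u"
    and "cyclic_variation_minus (cyclic_diff (one_period P u)) = 2"
    and "cyclic_variation_plus (one_period P u) = 2"
    and "y = - (circulant (one_period P (periodic_summation P g)) *\<^sub>v map_vec sgn (one_period P u))"
    and "num_pos (one_period P u) = num_pos y"
    and "num_neg (one_period P u) = num_neg y"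
  shows "num_pos (one_period P u) = num_neg (one_period P u) \<and>
         (num_zero (one_period P u) = 0 \<longrightarrow>
            P = 2 * num_pos (one_period P u) \<and> P = 2 * num_pos y)"
proof -
  have P: "P > 0" using assms(1) by simp
  obtain t1 :: nat where supp: "{t. g t \<noteq> 0} = {int t1 + int i | i::nat. True}"
    using assms(4) by blast
  have gpos: "g t > 0" if "g t \<noteq> 0" for t
    using strict_antimono_summable_pos[OF assms(3) supp assms(5) that] .
  define h where "h = periodic_summation P g"
  have hper: "periodic P h" unfolding h_def by (rule periodic_periodic_summation)
  have hpos: "h t > 0" for t
    unfolding h_def
  proof (rule periodic_summation_pos[OF P, where ?t1.0 = "int t1"])
    show "g summable_on UNIV" using assms(3) by (subst (asm) real_norm_def[symmetric]) (rule abs_summable_summable)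
    show "g t \<ge> 0" for t using gpos[of t] by (cases "g t = 0") auto
    show "g t > 0" if "t \<ge> int t1" for t
    proof (rule gpos)
      have "t = int t1 + int (nat (t - int t1))" using that by simp
      then show "g t \<noteq> 0" using supp by blast
    qed
  qed
  have alt: "\<not> cyclically_alternating P u"
    using cyclic_variation_plus_ge_3[OF P assms(6)] assms(8) by auto
  define F where "F = cyclic_convolution P h (\<lambda>j. sgn (u j))"
  have "map_vec sgn (one_period P u) = one_period P (\<lambda>j. sgn (u j))"
    by (auto simp: one_period_def)
  then have y: "dim_vec y = P" "\<And>t. t < P \<Longrightarrow> y $ t = - F (int t)"
    using circulant_mult_one_period[OF P hper]
    by (simp_all add: assms(9) F_def h_def circulant_def Let_def one_period_def)
  have counts_u: "num_pos (one_period P u) = count_period P (\<lambda>t. u t > 0)"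
    "num_neg (one_period P u) = count_period P (\<lambda>t. u t < 0)"
    unfolding num_pos_def num_neg_def card_one_period[symmetric]
    by (auto simp: one_period_def intro!: arg_cong[where f = card])
  have counts_y: "num_pos y = count_period P (\<lambda>t. F t < 0)" "num_neg y = count_period P (\<lambda>t. F t > 0)"
    unfolding num_pos_def num_neg_def card_one_period[symmetric]
    by (auto simp: y intro!: arg_cong[where f = card])
  have "\<not> num_neg (one_period P u) < num_pos (one_period P u)"
    using count_pos_convolution[OF P assms(6) alt hper hpos] assms(11)
    by (auto simp: counts_u counts_y F_def)
  moreover have "\<not> num_pos (one_period P u) < num_neg (one_period P u)"
  proof -
    have "periodic P (\<lambda>t. - u t)" using assms(6) by (simp add: periodic_def)
    moreover have "\<not> cyclically_alternating P (\<lambda>t. - u t)"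
      using cyclically_alternating_uminus[OF assms(6)] alt by blast
    moreover have "cyclic_convolution P h (\<lambda>j. sgn (- u j)) t = - F t" for t
      by (simp add: F_def cyclic_convolution_def sgn_minus sum_negf)
    ultimately show ?thesis
      using count_pos_convolution[OF P _ _ hper hpos, of "\<lambda>t. - u t"] assms(10)
      by (auto simp: counts_u counts_y)
  qed
  ultimately have eq: "num_pos (one_period P u) = num_neg (one_period P u)" by simp
  have "P = num_pos (one_period P u) + num_neg (one_period P u) + num_zero (one_period P u)"
  proof -
    let ?v = "one_period P u"
    have "{..<P} = {i. i < P \<and> ?v $ i > 0} \<union> {i. i < P \<and> ?v $ i < 0} \<union> {i. i < P \<and> ?v $ i = 0}"
      by auto
    then have "card {..<P} = card ({i. i < P \<and> ?v $ i > 0} \<union> {i. i < P \<and> ?v $ i < 0} \<union> {i. i < P \<and> ?v $ i = 0})"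
      by simp
    also have "\<dots> = num_pos ?v + num_neg ?v + num_zero ?v"
      unfolding num_pos_def num_neg_def num_zero_def
      by (subst card_Un_disjoint, auto simp: one_period_def)+
    finally show ?thesis by simp
  qed
  with eq assms(10) show ?thesis by simp
qed

end
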